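(* Let $\omega\in(0,1/2)$ and $\delta\in(0,\pi)$ be fixed, let $\alpha\in(\alpha^*,1)$, and let $$\lambda_\delta(n)=2(3-\alpha)\,\delta^{-(3-\alpha)}\,n^{\alpha-1}\int_0^{n\delta}\frac{1-\cos t}{t^\alpha}\,dt,\qquad n\in\mathbb{Z}^+ .$$ For $\gamma>0$ let $N^*(\gamma)$ be the optimal number of bubbles, i.e. the largest minimizer over $N\in\mathbb{Z}^+$ of $$E^{\mathrm{tot}}(N,\gamma)=2N+\frac{2\gamma}{\pi}\sum_{m=1}^{\infty}\frac{1}{\lambda_\delta(mN)}\left(\frac{\sin(m\pi\omega)}{m}\right)^2 .$$ Then $N^*(\gamma)$, as a function of $\gamma\in(0,\infty)$, is monotonically increasing (i.e. nondecreasing) with no upper bound.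
   Context: The numbers $\lambda_\delta(n)$ are the eigenvalues (on $e^{inx}$, with $2\pi$-periodic boundary conditions) of the one-dimensional nonlocal operator with power kernel $\rho_\delta(s)=\frac{3-\alpha}{\delta^{3-\alpha}|s|^\alpha}$, $0<|s|\le\delta$. The critical value $\alpha^*\in(0.308,0.309)$ is the unique $\alpha\in(0,1)$ with $\int_0^{3\pi/2}\frac{\cos t}{t^\alpha}\,dt=0$. *)

theory Defs
  imports "HOL-Analysis.Analysis"
begin

(* cos t / t powr a is unbounded at 0 but absolutely integrable for a < 1; the value 0 that the
   convention x / 0 = 0 gives at t = 0 is irrelevant. The exponent is unique: multiplied by
   (pi/2) powr a the integral becomes that of cos t * (2 * t / pi) powr (- a), which is strictly
   increasing in a at every t in (0, 3 * pi / 2) other than pi / 2. It exists because the integral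
   is -1 for a = 0 and tends to infinity for a --> 1. *)
definition critical_alpha :: real where
  "critical_alpha =
     (THE a. 0 < a \<and> a < 1 \<and> integral {0..3 * pi / 2} (\<lambda>t. cos t / t powr a) = 0)"

definition nonlocal_eigenvalue :: "real \<Rightarrow> real \<Rightarrow> nat \<Rightarrow> real" where
  "nonlocal_eigenvalue \<alpha> \<delta> n =
     2 * (3 - \<alpha>) * \<delta> powr (- (3 - \<alpha>)) * real n powr (\<alpha> - 1) *
     integral {0..real n * \<delta>} (\<lambda>t. (1 - cos t) / t powr \<alpha>)"

(* The series over m >= 1 is indexed by Suc m. *)
definition total_energy :: "real \<Rightarrow> real \<Rightarrow> real \<Rightarrow> nat \<Rightarrow> real \<Rightarrow> real" where
  "total_energy \<alpha> \<delta> \<omega> N \<gamma> =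
     2 * real N + 2 * \<gamma> / pi *
       (\<Sum>m. 1 / nonlocal_eigenvalue \<alpha> \<delta> (Suc m * N) *
             (sin (real (Suc m) * pi * \<omega>) / real (Suc m))\<^sup>2)"

(* For 0 < \<alpha> < 1, \<gamma> > 0 and \<delta> > 0 the series above converges and is nonnegative, so the energy
   is at least 2 * N and the set of minimizers is finite and nonempty. *)
definition optimal_bubbles :: "real \<Rightarrow> real \<Rightarrow> real \<Rightarrow> real \<Rightarrow> nat" where
  "optimal_bubbles \<alpha> \<delta> \<omega> \<gamma> =
     (GREATEST N. is_arg_min (\<lambda>M. total_energy \<alpha> \<delta> \<omega> M \<gamma>) (\<lambda>M. 1 \<le> M) N)"

end

theory Submission
  imports Defs
begin

text \<open>
  The energy has the form \<open>2 N + \<gamma> F(N)\<close> with \<open>F \<ge> 0\<close>, so that minimizers exist. Adding the two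
  minimality inequalities for \<open>\<gamma> < \<gamma>'\<close> shows that \<open>F\<close> is not larger at the minimizer for \<open>\<gamma>'\<close>.
  A smaller number with this property would beat the minimizer for \<open>\<gamma>\<close>, so the minimizer for \<open>\<gamma>'\<close>
  is at least as large (\<open>penalized_arg_min_mono\<close>).

  As \<open>\<gamma>\<close> grows, the term \<open>\<gamma> F(N)\<close> dominates, and the minimizers stay bounded only if \<open>F\<close> attains
  its infimum (\<open>penalized_arg_min_unbounded\<close>). Here \<open>F(N)\<close> is a weighted sum of the values
  \<open>1 / \<lambda>(m N)\<close>, and \<open>\<lambda>(n)\<close> converges to a finite limit \<open>L\<close>, so \<open>F(N)\<close> converges to the
  corresponding sum with \<open>1 / L\<close>. That value is not attained if \<open>\<lambda>(n) < L\<close> for all \<open>n\<close>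
  (\<open>dilated_series_infimum_not_attained\<close>).

  With \<open>p = 1 - \<alpha>\<close>, let \<open>G(x)\<close> be \<open>p\<close> times the integral of \<open>cos t / t powr \<alpha>\<close> over \<open>[0, x]\<close>.
  Then \<open>\<lambda>(n) = L (1 - G(x) / x powr p)\<close> at \<open>x = n \<delta>\<close>. The claim \<open>\<lambda>(n) \<longlonglongrightarrow> L\<close> holds because \<open>G\<close> is
  bounded, and \<open>\<lambda>(n) < L\<close> amounts to \<open>G(n \<delta>) > 0\<close>. The least value of \<open>G\<close> beyond \<open>\<pi> / 2\<close>, up to
  which \<open>G\<close> grows, is the one at \<open>3 \<pi> / 2\<close>; later oscillations are damped by the
  decreasing weight (\<open>powr_cos_integral_pos\<close>). The critical exponent is precisely the one at which
  \<open>G(3 \<pi> / 2)\<close> vanishes, and \<open>G(3 \<pi> / 2) > 0\<close> beyond it (\<open>powr_cos_integral_three_pi_half_pos\<close>).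
\<close>

section \<open>The cosine integral with a power weight\<close>

text \<open>
  For \<open>p > 0\<close> this is \<open>p\<close> times the integral of \<open>t powr (p - 1) * cos t\<close> over \<open>[0, x]\<close>, after one
  integration by parts. In this form the integrand is continuous up to \<open>0\<close>, and the exponent
  \<open>p = 0\<close>, where the original integral diverges, is included.
\<close>

definition powr_cos_integral :: "real \<Rightarrow> real \<Rightarrow> real" where
  "powr_cos_integral p x = x powr p * cos x + integral {0..x} (\<lambda>t. t powr p * sin t)"

lemma continuous_on_powr_sin:
  fixes p :: real
  assumes "0 \<le> p" "S \<subseteq> {0..}"
  shows "continuous_on S (\<lambda>t. t powr p * sin t)"
proof (cases "p = 0")
  case True
  then have *: "(\<lambda>t. t powr p * sin t) = sin" by auto
  show ?thesis unfolding * by (intro continuous_intros)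
next
  case False
  then show ?thesis
    using assms by (intro continuous_on_mult continuous_on_powr' continuous_intros) auto
qed

lemma powr_cos_integral_0 [simp]: "powr_cos_integral p 0 = 0"
  by (simp add: powr_cos_integral_def)

lemma continuous_on_powr_cos_integral:
  assumes "0 < p"
  shows "continuous_on {0..b} (powr_cos_integral p)"
proof -
  have "(\<lambda>t. t powr p * sin t) integrable_on {0..b}"
    using assms by (intro integrable_continuous_real continuous_on_powr_sin) auto
  from indefinite_integral_continuous_1[OF this] show ?thesis
    unfolding powr_cos_integral_def using assms
    by (intro continuous_on_add continuous_on_mult continuous_on_powr' continuous_intros) auto
qed

lemma has_real_derivative_powr_cos_integral:
  assumes "0 < p" "0 < x"
  shows "(powr_cos_integral p has_real_derivative p * x powr (p - 1) * cos x) (at x)"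
proof -
  have "((\<lambda>x. integral {0..x} (\<lambda>t. t powr p * sin t)) has_real_derivative x powr p * sin x)
          (at x within {0..x + 1})"
    using assms by (intro integral_has_real_derivative continuous_on_powr_sin) auto
  moreover have "at x within {0..x + 1} = at x"
    using assms by (intro at_within_interior) auto
  ultimately have I: "((\<lambda>x. integral {0..x} (\<lambda>t. t powr p * sin t)) has_real_derivative
      x powr p * sin x) (at x)" by simp
  show ?thesis
    unfolding powr_cos_integral_def
    by (rule derivative_eq_intros I refl | use assms in \<open>simp add: algebra_simps\<close>)+
qed

lemma has_integral_cos_div_powr:
  assumes "\<alpha> < 1" "0 \<le> x"
  shows "((\<lambda>t. cos t / t powr \<alpha>) has_integral powr_cos_integral (1 - \<alpha>) x / (1 - \<alpha>)) {0..x}"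
proof -
  have "((\<lambda>t. (1 - \<alpha>) * t powr (- \<alpha>) * cos t) has_integral
          powr_cos_integral (1 - \<alpha>) x - powr_cos_integral (1 - \<alpha>) 0) {0..x}"
    using assms has_real_derivative_powr_cos_integral[of "1 - \<alpha>"]
    by (intro fundamental_theorem_of_calculus_interior continuous_on_powr_cos_integral)
       (auto simp: has_real_derivative_iff_has_vector_derivative[symmetric])
  from has_integral_divide[OF this, of "1 - \<alpha>"] show ?thesis
    using assms by (simp add: powr_minus divide_simps mult.commute)
qed

lemma has_integral_one_minus_cos_div_powr:
  assumes "\<alpha> < 1" "0 \<le> x"
  shows "((\<lambda>t. (1 - cos t) / t powr \<alpha>) has_integral
          (x powr (1 - \<alpha>) - powr_cos_integral (1 - \<alpha>) x) / (1 - \<alpha>)) {0..x}"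
proof -
  have "((\<lambda>t. t powr (- \<alpha>) - cos t / t powr \<alpha>) has_integral
      x powr (- \<alpha> + 1) / (- \<alpha> + 1) - powr_cos_integral (1 - \<alpha>) x / (1 - \<alpha>)) {0..x}"
    using assms by (intro has_integral_diff has_integral_powr_from_0 has_integral_cos_div_powr) auto
  then show ?thesis
    by (simp add: powr_minus diff_divide_distrib divide_inverse algebra_simps)
qed

text \<open>
  The difference of the two sides has the derivative \<open>p * t powr (p - 1) * (1 - cos t)\<close>. It is
  nonnegative everywhere and strictly positive on \<open>(0, 1)\<close>, which avoids its zeros at the
  multiples of \<open>2 \<pi>\<close>. This is what makes the eigenvalues positive.
\<close>

lemma powr_cos_integral_less_powr:
  assumes "0 < p" "0 < x"
  shows "powr_cos_integral p x < x powr p"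
proof -
  define D where "D = (\<lambda>x. x powr p - powr_cos_integral p x)"
  have cont: "continuous_on {0..b} D" for b
    unfolding D_def using assms
    by (intro continuous_on_diff continuous_on_powr_cos_integral continuous_on_powr'
        continuous_intros) auto
  have deriv: "(D has_real_derivative p * t powr (p - 1) * (1 - cos t)) (at t)" if "0 < t" for t
    unfolding D_def
    by (rule derivative_eq_intros has_real_derivative_powr_cos_integral refl
        | use assms that in \<open>simp add: algebra_simps\<close>)+
  define y where "y = min x 1"
  have y: "0 < y" "y \<le> x" "y \<le> 1" using assms by (auto simp: y_def)
  have "D 0 < D y"
  proof (rule DERIV_pos_imp_increasing_open[OF y(1) _ cont])
    fix t assume t: "0 < t" "t < y"
    then have "cos t < cos 0"
      using y pi_gt3 by (intro cos_monotone_0_pi) auto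
    then show "\<exists>d. (D has_real_derivative d) (at t) \<and> d > 0"
      using deriv[of t] t assms by (intro exI[of _ "p * t powr (p - 1) * (1 - cos t)"]) auto
  qed
  also have "D y \<le> D x"
  proof (rule DERIV_nonneg_imp_nondecreasing[OF y(2)])
    fix t assume t: "y \<le> t" "t \<le> x"
    with y deriv[of t] assms show "\<exists>d. (D has_real_derivative d) (at t) \<and> d \<ge> 0"
      by (intro exI[of _ "p * t powr (p - 1) * (1 - cos t)"]) auto
  qed
  finally show ?thesis by (simp add: D_def)
qed

section \<open>The critical exponent\<close>

lemma cos_three_pi_half: "cos (3 * pi / 2) = 0"
  by (metis cos_3over2_pi times_divide_eq_left)

lemma sin_three_pi_half: "sin (3 * pi / 2) = - 1"
  by (metis sin_3over2_pi times_divide_eq_left)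

lemma powr_cos_integral_three_pi_half:
  "powr_cos_integral p (3 * pi / 2) = integral {0..3 * pi / 2} (\<lambda>t. t powr p * sin t)"
  by (simp add: powr_cos_integral_def cos_three_pi_half)

text \<open>
  Since \<open>sin\<close> changes sign at \<open>\<pi>\<close>, the comparison of exponents is made after rescaling: \<open>(t / \<pi>) powr p\<close>
  decreases in \<open>p\<close> where \<open>sin t > 0\<close> and increases in \<open>p\<close> where \<open>sin t < 0\<close>. Hence
  \<open>\<pi> powr (- p)\<close> times the value at \<open>3 \<pi> / 2\<close> is strictly decreasing in \<open>p\<close>, so that its sign can
  change only once.
\<close>

lemma powr_cos_integral_three_pi_half_pos_mono:
  assumes "0 \<le> p" "p < q" "0 \<le> powr_cos_integral q (3 * pi / 2)"
  shows "0 < powr_cos_integral p (3 * pi / 2)"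
proof -
  define k where "k = (\<lambda>t. pi powr (- p) * (t powr p * sin t) - pi powr (- q) * (t powr q * sin t))"
  have k: "k t = ((t / pi) powr p - (t / pi) powr q) * sin t" if "0 \<le> t" for t
    using that by (simp add: k_def powr_divide powr_minus field_simps)
  have cont: "continuous_on {0..3 * pi / 2} k"
    unfolding k_def using assms by (intro continuous_intros continuous_on_powr_sin) auto
  have nonneg: "0 \<le> k t" if t: "t \<in> {0..3 * pi / 2}" for t
  proof (cases "t \<le> pi")
    case True
    then have "(t / pi) powr q \<le> (t / pi) powr p"
      using t assms by (intro powr_mono') (auto simp: divide_simps)
    with True t show ?thesis by (simp add: k sin_ge_zero)
  next
    case False
    then have "(t / pi) powr p \<le> (t / pi) powr q"
      using assms by (intro powr_mono) (auto simp: divide_simps)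
    moreover have "sin t \<le> 0"
      using t False sin_le_zero[of t] pi_gt_zero by auto
    ultimately show ?thesis using t by (simp add: k mult_nonpos_nonpos)
  qed
  have "(1 / 2) powr q < (1 / 2 :: real) powr p"
    using assms by (intro powr_less_mono') auto
  then have "k (pi / 2) \<noteq> 0"
    by (simp add: k)
  moreover have "pi / 2 \<in> {0..3 * pi / 2}" by auto
  ultimately have "integral {0..3 * pi / 2} k \<noteq> 0"
    using integral_eq_0_iff[OF cont] nonneg pi_gt_zero by fastforce
  moreover have "0 \<le> integral {0..3 * pi / 2} k"
    using nonneg integrable_continuous_real[OF cont] by (intro integral_nonneg) auto
  ultimately have "0 < integral {0..3 * pi / 2} k" by linarith
  also have "\<dots> = pi powr (- p) * powr_cos_integral p (3 * pi / 2)
                  - pi powr (- q) * powr_cos_integral q (3 * pi / 2)"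
    unfolding k_def powr_cos_integral_three_pi_half using assms
    by (subst integral_diff)
       (auto intro!: integrable_continuous_real continuous_on_mult continuous_on_const
          continuous_on_powr_sin)
  finally have "0 < pi powr (- p) * powr_cos_integral p (3 * pi / 2)"
    using assms(3) by (smt (verit) mult_nonneg_nonneg powr_ge_zero)
  then show ?thesis by (simp add: zero_less_mult_iff)
qed

text \<open>
  As \<open>t powr p\<close> is discontinuous at \<open>p = t = 0\<close>, joint continuity of the integrand is delicate there.
  Dominated convergence needs continuity in \<open>p\<close> only, for each fixed \<open>t\<close>.
\<close>

lemma continuous_on_powr_cos_integral_three_pi_half:
  "continuous_on {0..1} (\<lambda>p. powr_cos_integral p (3 * pi / 2))"
  unfolding powr_cos_integral_three_pi_half continuous_on_sequentially comp_def
proof safe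
  fix u :: "nat \<Rightarrow> real" and p
  assume u: "\<forall>n. u n \<in> {0..1}" and lim: "u \<longlonglongrightarrow> p"
  show "(\<lambda>n. integral {0..3 * pi / 2} (\<lambda>t. t powr u n * sin t))
          \<longlonglongrightarrow> integral {0..3 * pi / 2} (\<lambda>t. t powr p * sin t)"
  proof (rule dominated_convergence(2))
    fix n
    show "(\<lambda>t. t powr u n * sin t) integrable_on {0..3 * pi / 2}"
      using u by (intro integrable_continuous_real continuous_on_powr_sin) auto
  next
    show "(\<lambda>t::real. 1 + t) integrable_on {0..3 * pi / 2}"
      by (intro integrable_continuous_real continuous_intros)
  next
    fix n and t :: real assume t: "t \<in> {0..3 * pi / 2}"
    have "t powr u n \<le> 1 + t"
    proof (cases "t \<le> 1")
      case True
      then have "t powr u n \<le> 1" using u t by (intro powr_le1) auto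
      then show ?thesis using t by auto
    next
      case False
      then have "t powr u n \<le> t powr 1" using u by (intro powr_mono) auto
      then show ?thesis using t by simp
    qed
    then show "norm (t powr u n * sin t) \<le> 1 + t"
      using mult_mono[of "t powr u n" "1 + t" "\<bar>sin t\<bar>" 1] t by (simp add: abs_mult)
  next
    fix t :: real assume "t \<in> {0..3 * pi / 2}"
    show "(\<lambda>n. t powr u n * sin t) \<longlonglongrightarrow> t powr p * sin t"
    proof (cases "t = 0")
      case False
      then show ?thesis by (intro tendsto_intros lim) auto
    qed simp
  qed
qed

lemma powr_cos_integral_0_three_pi_half: "powr_cos_integral 0 (3 * pi / 2) = 1"
proof -
  have "((\<lambda>t. t powr 0 * sin t) has_integral - cos (3 * pi / 2) - (- cos 0)) {0..3 * pi / 2}"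
    by (intro fundamental_theorem_of_calculus)
       (auto intro!: derivative_eq_intros
          simp: has_real_derivative_iff_has_vector_derivative[symmetric])
  then show ?thesis
    unfolding powr_cos_integral_three_pi_half cos_three_pi_half by (auto dest: integral_unique)
qed

lemma powr_cos_integral_1_three_pi_half: "powr_cos_integral 1 (3 * pi / 2) = - 1"
proof -
  have "((\<lambda>t. t powr 1 * sin t) has_integral
      (sin (3 * pi / 2) - 3 * pi / 2 * cos (3 * pi / 2)) - (sin 0 - 0 * cos 0)) {0..3 * pi / 2}"
    by (intro fundamental_theorem_of_calculus)
       (auto intro!: derivative_eq_intros
          simp: has_real_derivative_iff_has_vector_derivative[symmetric])
  then show ?thesis
    unfolding powr_cos_integral_three_pi_half cos_three_pi_half sin_three_pi_half
    by (auto dest: integral_unique)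
qed

text \<open>
  The exponents \<open>p = 0\<close> and \<open>p = 1\<close> give the values \<open>1\<close> and \<open>- 1\<close>, so a root exists between them;
  two roots would contradict the single change of sign.
\<close>

lemma critical_alpha_root:
  "0 < critical_alpha" "critical_alpha < 1"
  "powr_cos_integral (1 - critical_alpha) (3 * pi / 2) = 0"
proof -
  define h where "h = (\<lambda>p. powr_cos_integral p (3 * pi / 2))"
  have h_iff: "integral {0..3 * pi / 2} (\<lambda>t. cos t / t powr a) = 0 \<longleftrightarrow> h (1 - a) = 0"
    if "a < 1" for a
    using integral_unique[OF has_integral_cos_div_powr[OF that, of "3 * pi / 2"]] that
    by (simp add: h_def)
  obtain p where p: "0 \<le> p" "p \<le> 1" "h p = 0"
    using IVT2'[of h 1 0 0] continuous_on_powr_cos_integral_three_pi_half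
      powr_cos_integral_0_three_pi_half powr_cos_integral_1_three_pi_half
    by (auto simp: h_def)
  with powr_cos_integral_0_three_pi_half powr_cos_integral_1_three_pi_half
  have p': "0 < p" "p < 1"
    by (auto simp: h_def order.order_iff_strict)
  have "\<exists>!a. 0 < a \<and> a < 1 \<and> integral {0..3 * pi / 2} (\<lambda>t. cos t / t powr a) = 0"
  proof (rule ex1I[of _ "1 - p"])
    show "0 < 1 - p \<and> 1 - p < 1 \<and> integral {0..3 * pi / 2} (\<lambda>t. cos t / t powr (1 - p)) = 0"
      using p p' by (simp add: h_iff)
  next
    fix a assume "0 < a \<and> a < 1 \<and> integral {0..3 * pi / 2} (\<lambda>t. cos t / t powr a) = 0"
    then have "a < 1" "h (1 - a) = 0" by (auto simp: h_iff)
    then show "a = 1 - p"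
      using powr_cos_integral_three_pi_half_pos_mono[of p "1 - a"]
        powr_cos_integral_three_pi_half_pos_mono[of "1 - a" p] p p'
      unfolding h_def by (cases "1 - a" p rule: linorder_cases) auto
  qed
  from theI'[OF this, folded critical_alpha_def]
  show "0 < critical_alpha" "critical_alpha < 1"
    "powr_cos_integral (1 - critical_alpha) (3 * pi / 2) = 0"
    using h_iff[of critical_alpha] by (auto simp: h_def)
qed

lemma powr_cos_integral_three_pi_half_pos:
  assumes "critical_alpha < \<alpha>" "\<alpha> < 1"
  shows "0 < powr_cos_integral (1 - \<alpha>) (3 * pi / 2)"
  using powr_cos_integral_three_pi_half_pos_mono[of "1 - \<alpha>" "1 - critical_alpha"]
    critical_alpha_root assms by simp

section \<open>Positivity and boundedness of the cosine integral\<close>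

text \<open>
  Integrating \<open>cos\<close> against the weight \<open>t powr (p - 1)\<close> by parts, with the antiderivative \<open>1 + sin\<close>
  instead of \<open>sin\<close>, leaves a remainder of constant sign, because the weight decreases and
  \<open>1 + sin \<ge> 0\<close>. That antiderivative vanishes at \<open>3 \<pi> / 2\<close>, which turns this estimate into a lower
  bound by the value there.
\<close>

lemma powr_cos_integral_minus_mono:
  assumes "0 < p" "p < 1" "0 < x" "x \<le> y"
  shows "powr_cos_integral p x - p * x powr (p - 1) * (1 + sin x)
       \<le> powr_cos_integral p y - p * y powr (p - 1) * (1 + sin y)"
proof (rule DERIV_nonneg_imp_nondecreasing[OF assms(4)])
  fix t assume "x \<le> t" "t \<le> y"
  then have t: "0 < t" using assms by simp
  have "((\<lambda>t. powr_cos_integral p t - p * t powr (p - 1) * (1 + sin t)) has_real_derivative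
      p * (1 - p) * t powr (p - 2) * (1 + sin t)) (at t)"
    by (rule derivative_eq_intros has_real_derivative_powr_cos_integral refl
        | use assms t in \<open>simp add: algebra_simps\<close>)+
  moreover have "0 \<le> 1 + sin t"
    using sin_ge_minus_one[of t] by linarith
  ultimately show "\<exists>d. ((\<lambda>t. powr_cos_integral p t - p * t powr (p - 1) * (1 + sin t))
      has_real_derivative d) (at t) \<and> d \<ge> 0"
    using assms by (intro exI[of _ "p * (1 - p) * t powr (p - 2) * (1 + sin t)"]) auto
qed

text \<open>
  The same integration by parts with the antiderivative \<open>sin - 1 \<le> 0\<close> gives an upper bound.
\<close>

lemma powr_cos_integral_plus_antimono:
  assumes "0 < p" "p < 1" "0 < x" "x \<le> y"
  shows "powr_cos_integral p y + p * y powr (p - 1) * (1 - sin y)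
       \<le> powr_cos_integral p x + p * x powr (p - 1) * (1 - sin x)"
proof (rule DERIV_nonpos_imp_nonincreasing[OF assms(4)])
  fix t assume "x \<le> t" "t \<le> y"
  then have t: "0 < t" using assms by simp
  have "((\<lambda>t. powr_cos_integral p t + p * t powr (p - 1) * (1 - sin t)) has_real_derivative
      - (p * (1 - p) * t powr (p - 2) * (1 - sin t))) (at t)"
    by (rule derivative_eq_intros has_real_derivative_powr_cos_integral refl
        | use assms t in \<open>simp add: algebra_simps\<close>)+
  moreover have "0 \<le> p * (1 - p) * t powr (p - 2) * (1 - sin t)"
    using assms by simp
  ultimately show "\<exists>d. ((\<lambda>t. powr_cos_integral p t + p * t powr (p - 1) * (1 - sin t))
      has_real_derivative d) (at t) \<and> d \<le> 0"
    by (intro exI[of _ "- (p * (1 - p) * t powr (p - 2) * (1 - sin t))"]) auto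
qed

text \<open>
  The function rises from \<open>0\<close> on \<open>[0, \<pi> / 2]\<close>, falls to its value at \<open>3 \<pi> / 2\<close>, and never drops
  below that value again.
\<close>

lemma powr_cos_integral_pos:
  assumes p: "0 < p" "p < 1" and crit: "0 < powr_cos_integral p (3 * pi / 2)" and x: "0 < x"
  shows "0 < powr_cos_integral p x"
proof -
  consider "x \<le> pi / 2" | "pi / 2 \<le> x" "x \<le> 3 * pi / 2" | "3 * pi / 2 \<le> x" by linarith
  then show ?thesis
  proof cases
    case 1
    have "powr_cos_integral p 0 < powr_cos_integral p x"
    proof (rule DERIV_pos_imp_increasing_open[OF x _ continuous_on_powr_cos_integral[OF p(1)]])
      fix t assume t: "0 < t" "t < x"
      then have "0 < cos t" using 1 by (intro cos_gt_zero) auto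
      then show "\<exists>d. (powr_cos_integral p has_real_derivative d) (at t) \<and> d > 0"
        using has_real_derivative_powr_cos_integral[OF p(1) t(1)] p t
        by (intro exI[of _ "p * t powr (p - 1) * cos t"]) auto
    qed
    then show ?thesis by simp
  next
    case 2
    have "powr_cos_integral p (3 * pi / 2) \<le> powr_cos_integral p x"
    proof (rule DERIV_nonpos_imp_nonincreasing[OF 2(2)])
      fix t assume t: "x \<le> t" "t \<le> 3 * pi / 2"
      then have "0 < t" using x by simp
      have "0 \<le> cos (t - pi)" using t 2 by (intro cos_ge_zero) auto
      then have "cos t \<le> 0" by simp
      then show "\<exists>d. (powr_cos_integral p has_real_derivative d) (at t) \<and> d \<le> 0"
        using has_real_derivative_powr_cos_integral[OF p(1) \<open>0 < t\<close>] p
        by (intro exI[of _ "p * t powr (p - 1) * cos t"]) (auto simp: mult_nonneg_nonpos)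
    qed
    with crit show ?thesis by simp
  next
    case 3
    have "powr_cos_integral p (3 * pi / 2)
        \<le> powr_cos_integral p x - p * x powr (p - 1) * (1 + sin x)"
      using powr_cos_integral_minus_mono[OF p _ 3] by (simp add: sin_three_pi_half)
    moreover have "0 \<le> 1 + sin x"
      using sin_ge_minus_one[of x] by linarith
    then have "0 \<le> p * x powr (p - 1) * (1 + sin x)" using p by simp
    ultimately show ?thesis using crit by linarith
  qed
qed

lemma powr_cos_integral_div_powr_tendsto_0:
  assumes p: "0 < p" "p < 1" and pos: "\<And>x. 0 < x \<Longrightarrow> 0 < powr_cos_integral p x"
  shows "((\<lambda>x. powr_cos_integral p x / x powr p) \<longlongrightarrow> 0) at_top"
proof -
  define C where "C = powr_cos_integral p 1 + p * (1 - sin 1)"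
  have le: "powr_cos_integral p x \<le> C" if "1 \<le> x" for x
  proof -
    have "0 \<le> p * x powr (p - 1) * (1 - sin x)" using p by simp
    then show ?thesis
      using powr_cos_integral_plus_antimono[OF p _ that] by (simp add: C_def)
  qed
  have "((\<lambda>x. x powr (- p)) \<longlongrightarrow> 0) at_top"
    using p by (intro tendsto_neg_powr filterlim_ident) auto
  then have lim: "((\<lambda>x. C * x powr (- p)) \<longlongrightarrow> 0) at_top"
    using tendsto_mult_right_zero by blast
  show ?thesis
  proof (rule tendsto_sandwich[OF _ _ tendsto_const lim])
    show "\<forall>\<^sub>F x in at_top. 0 \<le> powr_cos_integral p x / x powr p"
      using eventually_gt_at_top[of 0] by eventually_elim (simp add: pos less_imp_le)
    show "\<forall>\<^sub>F x in at_top. powr_cos_integral p x / x powr p \<le> C * x powr (- p)"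
      using eventually_ge_at_top[of 1]
      by eventually_elim (use le in \<open>auto simp: powr_minus divide_inverse intro!: mult_right_mono\<close>)
  qed
qed

section \<open>The eigenvalues\<close>

text \<open>
  This is \<open>\<lambda>(n)\<close> with the term \<open>cos t\<close> of the integrand removed, which makes it independent of \<open>n\<close>.
\<close>

definition eigenvalue_limit :: "real \<Rightarrow> real \<Rightarrow> real" where
  "eigenvalue_limit \<alpha> \<delta> = 2 * (3 - \<alpha>) / ((1 - \<alpha>) * \<delta>\<^sup>2)"

lemma nonlocal_eigenvalue_eq:
  assumes "\<alpha> < 1" "0 < \<delta>" "1 \<le> n"
  shows "nonlocal_eigenvalue \<alpha> \<delta> n = eigenvalue_limit \<alpha> \<delta> *
    (1 - powr_cos_integral (1 - \<alpha>) (real n * \<delta>) / (real n * \<delta>) powr (1 - \<alpha>))"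
proof -
  define x where "x = real n * \<delta>"
  define p where "p = 1 - \<alpha>"
  have x: "0 < x" and p: "0 < p" using assms by (auto simp: x_def p_def)
  have int: "integral {0..x} (\<lambda>t. (1 - cos t) / t powr \<alpha>) = (x powr p - powr_cos_integral p x) / p"
    using integral_unique[OF has_integral_one_minus_cos_div_powr] assms x by (simp add: p_def)
  have "\<delta> powr (- (3 - \<alpha>)) = \<delta> powr (- 2) * \<delta> powr (- p)"
    by (simp add: p_def flip: powr_add)
  also have "\<delta> powr (- 2) = 1 / \<delta>\<^sup>2"
    using assms by (simp add: powr_minus_divide)
  finally have "\<delta> powr (- (3 - \<alpha>)) * real n powr (\<alpha> - 1) = 1 / \<delta>\<^sup>2 * x powr (- p)"
    using assms by (simp add: x_def p_def powr_mult)
  then have "nonlocal_eigenvalue \<alpha> \<delta> n =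
      2 * (3 - \<alpha>) * (1 / \<delta>\<^sup>2 * x powr (- p)) * ((x powr p - powr_cos_integral p x) / p)"
    unfolding nonlocal_eigenvalue_def x_def[symmetric] int by (simp add: mult.assoc)
  also have "\<dots> = eigenvalue_limit \<alpha> \<delta> * (1 - powr_cos_integral p x / x powr p)"
    using x p by (simp add: eigenvalue_limit_def p_def[symmetric] powr_minus field_simps)
  finally show ?thesis by (simp add: x_def p_def)
qed

lemma eigenvalue_limit_pos: "\<alpha> < 1 \<Longrightarrow> 0 < \<delta> \<Longrightarrow> 0 < eigenvalue_limit \<alpha> \<delta>"
  by (simp add: eigenvalue_limit_def)

lemma nonlocal_eigenvalue_pos:
  assumes "\<alpha> < 1" "0 < \<delta>" "1 \<le> n"
  shows "0 < nonlocal_eigenvalue \<alpha> \<delta> n"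
proof -
  define x where "x = real n * \<delta>"
  have x: "0 < x" using assms by (auto simp: x_def)
  then have "powr_cos_integral (1 - \<alpha>) x / x powr (1 - \<alpha>) < 1"
    using powr_cos_integral_less_powr[of "1 - \<alpha>" x] assms(1) by simp
  then show ?thesis
    unfolding nonlocal_eigenvalue_eq[OF assms] x_def[symmetric]
    using eigenvalue_limit_pos[OF assms(1,2)] by (intro mult_pos_pos) auto
qed

lemma nonlocal_eigenvalue_less_limit:
  assumes "critical_alpha < \<alpha>" "\<alpha> < 1" "0 < \<delta>" "1 \<le> n"
  shows "nonlocal_eigenvalue \<alpha> \<delta> n < eigenvalue_limit \<alpha> \<delta>"
proof -
  define x where "x = real n * \<delta>"
  have x: "0 < x" using assms by (auto simp: x_def)
  then have "0 < powr_cos_integral (1 - \<alpha>) x"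
    using assms critical_alpha_root(1)
    by (intro powr_cos_integral_pos[OF _ _ powr_cos_integral_three_pi_half_pos]) auto
  with x have "0 < powr_cos_integral (1 - \<alpha>) x / x powr (1 - \<alpha>)" by simp
  with eigenvalue_limit_pos[OF assms(2,3)]
  have "eigenvalue_limit \<alpha> \<delta> * (1 - powr_cos_integral (1 - \<alpha>) x / x powr (1 - \<alpha>))
      < eigenvalue_limit \<alpha> \<delta> * 1"
    by (intro mult_strict_left_mono) auto
  then show ?thesis
    unfolding nonlocal_eigenvalue_eq[OF assms(2-4)] x_def by simp
qed

lemma nonlocal_eigenvalue_tendsto_limit:
  assumes "critical_alpha < \<alpha>" "\<alpha> < 1" "0 < \<delta>"
  shows "nonlocal_eigenvalue \<alpha> \<delta> \<longlonglongrightarrow> eigenvalue_limit \<alpha> \<delta>"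
proof -
  have "((\<lambda>x. powr_cos_integral (1 - \<alpha>) x / x powr (1 - \<alpha>)) \<longlongrightarrow> 0) at_top"
    using assms critical_alpha_root(1)
    by (intro powr_cos_integral_div_powr_tendsto_0
        powr_cos_integral_pos[OF _ _ powr_cos_integral_three_pi_half_pos]) auto
  moreover have "filterlim (\<lambda>n. real n * \<delta>) at_top sequentially"
    using assms
    by (intro filterlim_at_top_mult_tendsto_pos[OF tendsto_const] filterlim_real_sequentially)
  ultimately have "(\<lambda>n. powr_cos_integral (1 - \<alpha>) (real n * \<delta>) / (real n * \<delta>) powr (1 - \<alpha>))
      \<longlonglongrightarrow> 0"
    by (rule filterlim_compose)
  then have "(\<lambda>n. eigenvalue_limit \<alpha> \<delta> *
      (1 - powr_cos_integral (1 - \<alpha>) (real n * \<delta>) / (real n * \<delta>) powr (1 - \<alpha>)))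
      \<longlonglongrightarrow> eigenvalue_limit \<alpha> \<delta> * (1 - 0)"
    by (intro tendsto_intros)
  moreover have "\<forall>\<^sub>F n in sequentially. eigenvalue_limit \<alpha> \<delta> *
      (1 - powr_cos_integral (1 - \<alpha>) (real n * \<delta>) / (real n * \<delta>) powr (1 - \<alpha>))
      = nonlocal_eigenvalue \<alpha> \<delta> n"
    using eventually_ge_at_top[of 1]
    by eventually_elim (use assms in \<open>simp add: nonlocal_eigenvalue_eq\<close>)
  ultimately show ?thesis by (auto dest: Lim_transform_eventually)
qed

section \<open>Dilated weighted series\<close>

lemma summable_dilated:
  fixes q w :: "nat \<Rightarrow> real"
  assumes "q \<longlonglongrightarrow> l" "summable w" "\<And>m. 0 \<le> w m"
  shows "summable (\<lambda>m. q (Suc m * N) * w m)"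
proof -
  obtain B where B: "\<And>n. \<bar>q n\<bar> \<le> B"
    using convergent_imp_Bseq[of q] assms(1) by (auto simp: convergent_def Bseq_def)
  show ?thesis
  proof (rule summable_comparison_test[OF _ summable_mult[OF assms(2)]])
    show "\<exists>M. \<forall>m\<ge>M. norm (q (Suc m * N) * w m) \<le> B * w m"
      using B assms(3) by (auto simp: abs_mult intro!: mult_right_mono)
  qed
qed

text \<open>
  Every value of the series at \<open>N \<ge> 1\<close> exceeds \<open>l * suminf w\<close>, strictly so because of the first weight, whereas
  the values along \<open>M \<longlonglongrightarrow> \<infinity>\<close> come arbitrarily close to it: all arguments \<open>(m + 1) M\<close> are at least \<open>M\<close>,
  so that \<open>q\<close> is uniformly close to \<open>l\<close> at all of them.
\<close>

lemma dilated_series_infimum_not_attained: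
  fixes q w :: "nat \<Rightarrow> real"
  assumes lim: "q \<longlonglongrightarrow> l" and gt: "\<And>n. 1 \<le> n \<Longrightarrow> l < q n"
    and w: "summable w" "\<And>m. 0 \<le> w m" "0 < w 0" and N: "1 \<le> N"
  shows "\<forall>\<^sub>F M in sequentially. (\<Sum>m. q (Suc m * M) * w m) < (\<Sum>m. q (Suc m * N) * w m)"
proof -
  define F where "F = (\<lambda>N. \<Sum>m. q (Suc m * N) * w m)"
  define W where "W = suminf w"
  have W: "0 < W" unfolding W_def using w by (intro suminf_pos2[of _ 0]) auto
  have sum: "summable (\<lambda>m. q (Suc m * M) * w m)" for M
    using summable_dilated[OF lim w(1,2)] .
  have "0 < (\<Sum>m. q (Suc m * N) * w m - l * w m)"
  proof (rule suminf_pos2[of _ 0])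
    show "summable (\<lambda>m. q (Suc m * N) * w m - l * w m)"
      by (intro summable_diff sum summable_mult w(1))
    show "0 \<le> q (Suc m * N) * w m - l * w m" for m
      using gt[of "Suc m * N"] N w(2)[of m] by (simp add: mult_right_mono flip: left_diff_distrib)
    show "0 < q (Suc 0 * N) * w 0 - l * w 0"
      using gt[of N] N w(3) by simp
  qed
  also have "\<dots> = F N - l * W"
    unfolding F_def W_def using sum w(1)
    by (simp add: suminf_diff[symmetric] suminf_mult summable_mult)
  finally have "l * W < F N" by simp
  then have "l < F N / W" using W by (simp add: field_simps)
  then obtain c where c: "l < c" "c < F N / W" using dense by blast
  from lim c(1) have "\<forall>\<^sub>F n in sequentially. q n < c" by (rule order_tendstoD)
  then obtain K where K: "\<And>n. K \<le> n \<Longrightarrow> q n < c"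
    by (auto simp: eventually_sequentially)
  have "F M < F N" if "K \<le> M" for M
  proof -
    have "F M \<le> (\<Sum>m. c * w m)"
      unfolding F_def
    proof (rule suminf_le[OF _ sum summable_mult[OF w(1)]])
      fix m
      have "K \<le> Suc m * M" using that by simp
      then show "q (Suc m * M) * w m \<le> c * w m"
        using K w(2) by (intro mult_right_mono) (auto simp: less_imp_le)
    qed
    also have "\<dots> = c * W" using w(1) by (simp add: W_def suminf_mult)
    also have "\<dots> < F N" using c(2) W by (simp add: field_simps)
    finally show ?thesis .
  qed
  then show ?thesis unfolding F_def eventually_sequentially by blast
qed

section \<open>Penalized minimization over the positive integers\<close>

text \<open>
  The lower bound confines all minimizers to a finite range, so a minimizer exists and \<open>GREATEST\<close>
  picks one.
\<close>

lemma is_arg_min_Greatest: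
  fixes E :: "nat \<Rightarrow> real"
  assumes "\<And>N. 1 \<le> N \<Longrightarrow> 2 * real N \<le> E N"
  shows "is_arg_min E (\<lambda>M. 1 \<le> M) (GREATEST N. is_arg_min E (\<lambda>M. 1 \<le> M) N)"
proof -
  define K where "K = nat \<lceil>E 1\<rceil> + 1"
  have K: "E 1 < E N" if "K < N" for N
  proof -
    have "E 1 \<le> real K" unfolding K_def by linarith
    also have "\<dots> < 2 * real N" using that by simp
    also have "\<dots> \<le> E N" using that by (intro assms) simp
    finally show ?thesis .
  qed
  have "\<exists>N. is_arg_min E (\<lambda>M. M \<in> {1..K}) N"
    by (intro ex_is_arg_min_if_finite) (auto simp: K_def)
  then obtain N where N: "1 \<le> N" "N \<le> K" "\<And>M. 1 \<le> M \<Longrightarrow> M \<le> K \<Longrightarrow> E N \<le> E M"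
    by (force simp: is_arg_min_def not_less)
  have "E N \<le> E M" if "1 \<le> M" for M
  proof (cases "M \<le> K")
    case False
    have "E N \<le> E 1" by (intro N) (auto simp: K_def)
    also have "E 1 < E M" using False by (intro K) simp
    finally show ?thesis by simp
  qed (use N that in auto)
  then have "is_arg_min E (\<lambda>M. 1 \<le> M) N"
    using N by (auto simp: is_arg_min_def not_less)
  moreover have "M \<le> K" if "is_arg_min E (\<lambda>M. 1 \<le> M) M" for M
    using that K[of M] by (force simp: is_arg_min_def)
  ultimately show ?thesis by (rule GreatestI_nat)
qed

lemma penalized_arg_min_mono:
  fixes F :: "nat \<Rightarrow> real"
  assumes "0 < a" "a < b"
    and M: "is_arg_min (\<lambda>N. 2 * real N + a * F N) (\<lambda>N. 1 \<le> N) M"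
    and N: "is_arg_min (\<lambda>N. 2 * real N + b * F N) (\<lambda>N. 1 \<le> N) N"
  shows "M \<le> N"
proof (rule ccontr)
  assume "\<not> M \<le> N"
  from M N have 1: "2 * real M + a * F M \<le> 2 * real N + a * F N"
    and 2: "2 * real N + b * F N \<le> 2 * real M + b * F M"
    by (auto simp: is_arg_min_def not_less)
  then have "(b - a) * F N \<le> (b - a) * F M"
    by (simp add: algebra_simps)
  then have "F N \<le> F M" using \<open>a < b\<close> by simp
  then have "a * F N \<le> a * F M" using \<open>0 < a\<close> by simp
  then show False using 1 \<open>\<not> M \<le> N\<close> by simp
qed

text \<open>
  If the minimizers were at most \<open>K\<close>, some \<open>M\<close> would have a smaller \<open>F\<close> than all of \<open>1, \<dots>, K\<close>, and a
  large weight on \<open>F\<close> would make \<open>M\<close> better than each of them.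
\<close>

lemma penalized_arg_min_unbounded:
  fixes F :: "nat \<Rightarrow> real"
  assumes dec: "\<And>N. 1 \<le> N \<Longrightarrow> \<forall>\<^sub>F M in sequentially. F M < F N"
    and arg_min: "\<And>\<gamma>. 0 < \<gamma> \<Longrightarrow> is_arg_min (\<lambda>N. 2 * real N + \<gamma> * F N) (\<lambda>N. 1 \<le> N) (f \<gamma>)"
  shows "\<not> bdd_above (f ` {0<..})"
proof
  assume "bdd_above (f ` {0<..})"
  then obtain K where K: "\<And>\<gamma>. 0 < \<gamma> \<Longrightarrow> f \<gamma> \<le> K"
    by (auto simp: bdd_above_def)
  have "\<forall>\<^sub>F M in sequentially. 1 \<le> M \<and> (\<forall>N\<in>{1..K}. F M < F N)"
    using dec by (intro eventually_conj eventually_ge_at_top eventually_ball_finite) auto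
  then obtain M where M: "1 \<le> M" "\<And>N. N \<in> {1..K} \<Longrightarrow> F M < F N"
    by (auto simp: eventually_sequentially)
  \<comment> \<open>Inserting \<open>1\<close> keeps the set nonempty in case \<open>K = 0\<close>.\<close>
  define gap where "gap = Min (insert 1 ((\<lambda>N. F N - F M) ` {1..K}))"
  have gap: "0 < gap" unfolding gap_def using M by (subst Min_gr_iff) auto
  \<comment> \<open>For this weight the gain \<open>\<gamma> * gap\<close> from moving to \<open>M\<close> pays for the whole linear cost \<open>2 * M\<close>.\<close>
  define \<gamma> where "\<gamma> = 2 * real M / gap"
  have \<gamma>: "0 < \<gamma>" using gap M by (simp add: \<gamma>_def)
  from arg_min[OF \<gamma>] M have f: "1 \<le> f \<gamma>"
    and le: "2 * real (f \<gamma>) + \<gamma> * F (f \<gamma>) \<le> 2 * real M + \<gamma> * F M"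
    by (auto simp: is_arg_min_def not_less)
  have "gap \<le> F (f \<gamma>) - F M"
    unfolding gap_def using f K[OF \<gamma>] by (intro Min_le) auto
  then have "\<gamma> * gap \<le> \<gamma> * (F (f \<gamma>) - F M)" using \<gamma> by simp
  moreover have "\<gamma> * gap = 2 * real M" using gap by (simp add: \<gamma>_def)
  ultimately show False using le f by (simp add: algebra_simps)
qed

section \<open>The optimal number of bubbles\<close>

theorem theorem3p2:
  fixes \<omega> \<delta> \<alpha> :: real
  assumes "\<omega> \<in> {0<..<1/2}"
    and "\<delta> \<in> {0<..<pi}"
    and "\<alpha> \<in> {critical_alpha<..<1}"
  shows "mono_on {0<..} (optimal_bubbles \<alpha> \<delta> \<omega>)
       \<and> \<not> bdd_above (optimal_bubbles \<alpha> \<delta> \<omega> ` {0<..})"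
proof -
  have \<alpha>: "critical_alpha < \<alpha>" "\<alpha> < 1" and \<delta>: "0 < \<delta>" using assms by auto
  define w where "w = (\<lambda>m. (sin (real (Suc m) * pi * \<omega>) / real (Suc m))\<^sup>2)"
  define q where "q = (\<lambda>n. 1 / nonlocal_eigenvalue \<alpha> \<delta> n)"
  define F where "F = (\<lambda>N. 2 / pi * (\<Sum>m. q (Suc m * N) * w m))"
  have lim: "q \<longlonglongrightarrow> 1 / eigenvalue_limit \<alpha> \<delta>"
    unfolding q_def using eigenvalue_limit_pos[OF \<alpha>(2) \<delta>]
    by (intro tendsto_intros nonlocal_eigenvalue_tendsto_limit \<alpha> \<delta>) auto
  have gt: "1 / eigenvalue_limit \<alpha> \<delta> < q n" if "1 \<le> n" for n
    unfolding q_def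
    using nonlocal_eigenvalue_less_limit[OF \<alpha> \<delta> that] nonlocal_eigenvalue_pos[OF \<alpha>(2) \<delta> that]
    by (intro divide_strict_left_mono) auto
  have w_summable: "summable w"
  proof (rule summable_comparison_test)
    show "summable (\<lambda>m. inverse ((real (Suc m))\<^sup>2))"
      using inverse_power_summable[of 2, where 'a = real] by (subst summable_Suc_iff) auto
    have "w m \<le> inverse ((real (Suc m))\<^sup>2)" for m
      unfolding w_def power_divide
      by (simp add: divide_inverse mult_left_le_one_le abs_square_le_1)
    then show "\<exists>M. \<forall>m\<ge>M. norm (w m) \<le> inverse ((real (Suc m))\<^sup>2)"
      by (auto simp: w_def)
  qed
  have w_nonneg: "0 \<le> w m" for m by (simp add: w_def)
  have "0 < pi * \<omega>" "pi * \<omega> < pi * 1"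
    using assms by (auto intro!: mult_strict_left_mono)
  then have "0 < sin (pi * \<omega>)" by (intro sin_gt_zero) auto
  then have w_0: "0 < w 0" by (simp add: w_def)
  have energy: "total_energy \<alpha> \<delta> \<omega> N \<gamma> = 2 * real N + \<gamma> * F N" for N \<gamma>
    by (simp add: total_energy_def F_def q_def w_def)
  have F_nonneg: "0 \<le> F N" if "1 \<le> N" for N
    unfolding F_def
  proof (intro mult_nonneg_nonneg suminf_nonneg summable_dilated[OF lim w_summable w_nonneg])
    fix m
    have "1 \<le> Suc m * N" using that by simp
    from nonlocal_eigenvalue_pos[OF \<alpha>(2) \<delta> this] show "0 \<le> q (Suc m * N)"
      by (simp add: q_def)
  qed (auto simp: w_nonneg)
  have arg_min: "is_arg_min (\<lambda>N. 2 * real N + \<gamma> * F N) (\<lambda>N. 1 \<le> N) (optimal_bubbles \<alpha> \<delta> \<omega> \<gamma>)"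
    if "0 < \<gamma>" for \<gamma>
    unfolding optimal_bubbles_def energy
    using that F_nonneg by (intro is_arg_min_Greatest) simp
  have F_dec: "\<forall>\<^sub>F M in sequentially. F M < F N" if "1 \<le> N" for N
  proof -
    have "\<forall>\<^sub>F M in sequentially. (\<Sum>m. q (Suc m * M) * w m) < (\<Sum>m. q (Suc m * N) * w m)"
      using gt by (intro dilated_series_infimum_not_attained[OF lim _ w_summable w_nonneg w_0 that])
    then show ?thesis
      unfolding F_def by (rule eventually_mono) (rule mult_strict_left_mono, assumption, simp)
  qed
  show ?thesis
  proof
    show "mono_on {0<..} (optimal_bubbles \<alpha> \<delta> \<omega>)"
    proof (rule mono_onI)
      fix a b :: real assume "a \<in> {0<..}" "b \<in> {0<..}" "a \<le> b"
      then show "optimal_bubbles \<alpha> \<delta> \<omega> a \<le> optimal_bubbles \<alpha> \<delta> \<omega> b"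
        using penalized_arg_min_mono[of a b, OF _ _ arg_min[of a] arg_min[of b]]
        by (cases "a = b") auto
    qed
    show "\<not> bdd_above (optimal_bubbles \<alpha> \<delta> \<omega> ` {0<..})"
      by (rule penalized_arg_min_unbounded[OF F_dec arg_min])
  qed
qed

end
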